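(* There exists an infinite family $\mathcal{F}$ of pairwise intersecting right-angled triangles in $\mathbb{R}^2$, with bounded diameters (there is $R>0$ with $\mathrm{diam}(T)<R$ for all $T\in\mathcal{F}$) and non-zero areas, such that no finite set of points in $\mathbb{R}^2$ meets every triangle of $\mathcal{F}$.
   Context: Triangles are closed and not required to have axis-parallel legs. *)

theory Defs
  imports "HOL-Analysis.Analysis"
begin

definition right_triangle :: "(real^2) set \<Rightarrow> bool" where
  "right_triangle T \<longleftrightarrow>
     (\<exists>a b c. \<not> collinear {a, b, c} \<and> orthogonal (b - a) (c - a) \<and> T = convex hull {a, b, c})"

end

theory Submission imports Defs begin

text \<open>
  The tangents to the parabola \<open>y = x\<^sup>2\<close> at parameters \<open>s\<close> and \<open>t\<close> meet at \<open>((s + t) / 2, s t)\<close>,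
  so their segments over \<open>0 \<le> x \<le> 1\<close> pairwise intersect for \<open>s\<close>, \<open>t\<close> in \<open>(0, 1]\<close>. Thicken the
  segment at \<open>t\<close> to a right-angled triangle so thin that it stays in the strip
  \<open>t\<^sup>2 / 2 \<le> 2 t x - y \<le> t\<^sup>2\<close>. A fixed point lies outside this strip for all small \<open>t > 0\<close>:
  letting \<open>t \<rightarrow> 0\<close> forces \<open>y = 0\<close>, then \<open>x = 0\<close>, which contradicts the lower bound. Hence a
  finite set of points misses the triangles with small \<open>t\<close>.
\<close>

text \<open>
  The leg from \<open>(0, -t\<^sup>2)\<close> to \<open>(1, 2 t - t\<^sup>2)\<close> lies on the tangent at \<open>t\<close>; the other leg is
  \<open>t\<^sup>2 / 10\<close> times the normal vector \<open>(-2 t, 1)\<close>.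
\<close>

definition tangent_triangle :: "real \<Rightarrow> (real^2) set" where
  "tangent_triangle t = convex hull
     {vector [0, - t\<^sup>2], vector [1, 2 * t - t\<^sup>2], vector [- (t^3 / 5), - t\<^sup>2 + t\<^sup>2 / 10]}"

text \<open>Collinearity of \<open>0\<close>, \<open>b - a\<close>, \<open>c - a\<close> is the
  equality case of Cauchy-Schwarz; with inner product zero, one of the two vectors would have to
  vanish.\<close>

lemma not_collinear_orthogonal:
  fixes a b c :: "'a::euclidean_space"
  assumes "orthogonal (b - a) (c - a)" "b \<noteq> a" "c \<noteq> a"
  shows "\<not> collinear {a, b, c}"
proof
  assume "collinear {a, b, c}"
  then have "collinear {0, b - a, c - a}"
    using collinear_3[of b a c] by (simp add: insert_commute)
  then show False
    using assms norm_cauchy_schwarz_equal[of "b - a" "c - a"] by (simp add: orthogonal_def)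
qed

lemma right_triangle_tangent_triangle:
  assumes "t > 0"
  shows "right_triangle (tangent_triangle t)"
  unfolding right_triangle_def tangent_triangle_def
proof (intro exI conjI)
  show "orthogonal (vector [1, 2 * t - t\<^sup>2] - vector [0, - t\<^sup>2])
      (vector [- (t^3 / 5), - t\<^sup>2 + t\<^sup>2 / 10] - (vector [0, - t\<^sup>2] :: real^2))"
    by (simp add: orthogonal_def inner_vec_def sum_2 power2_eq_square power3_eq_cube)
  then show "\<not> collinear {vector [0, - t\<^sup>2], vector [1, 2 * t - t\<^sup>2],
      vector [- (t^3 / 5), - t\<^sup>2 + t\<^sup>2 / 10] :: real^2}"
    using assms by (intro not_collinear_orthogonal) (auto simp: vec_eq_iff forall_2)
qed simp

lemma measure_tangent_triangle:
  assumes "t > 0"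
  shows "measure lborel (tangent_triangle t) > 0"
proof -
  \<comment> \<open>The product of the two leg lengths,
    \<open>(1 + 4 * t\<^sup>2) * t\<^sup>2 / 10\<close>, which is twice the area.\<close>
  have "t\<^sup>2 / 10 + 2 * t^4 / 5 > 0"
    using assms by (simp add: add_pos_pos)
  then show ?thesis
    unfolding tangent_triangle_def
    by (simp add: content_triangle algebra_simps power2_eq_square power3_eq_cube power4_eq_xxxx)
qed

lemma tangent_point_in_tangent_triangle:
  assumes "0 \<le> x" "x \<le> 1"
  shows "vector [x, 2 * t * x - t\<^sup>2] \<in> tangent_triangle t"
proof -
  have "(1 - x) *\<^sub>R vector [0, - t\<^sup>2] + x *\<^sub>R vector [1, 2 * t - t\<^sup>2] \<in> tangent_triangle t"
    unfolding tangent_triangle_def using assms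
    by (intro convexD[OF convex_convex_hull] hull_inc) auto
  moreover have "(1 - x) *\<^sub>R vector [0, - t\<^sup>2] + x *\<^sub>R vector [1, 2 * t - t\<^sup>2]
      = (vector [x, 2 * t * x - t\<^sup>2] :: real^2)"
    by (simp add: vec_eq_iff forall_2 algebra_simps)
  ultimately show ?thesis by simp
qed

lemma tangent_triangles_intersect:
  assumes "0 \<le> s" "s \<le> 1" "0 \<le> t" "t \<le> 1"
  shows "tangent_triangle s \<inter> tangent_triangle t \<noteq> {}"
proof -
  have "2 * s * ((s + t) / 2) - s\<^sup>2 = s * t" "2 * t * ((s + t) / 2) - t\<^sup>2 = s * t"
    by (simp_all add: field_simps power2_eq_square)
  then have "vector [(s + t) / 2, s * t] \<in> tangent_triangle s"
    "vector [(s + t) / 2, s * t] \<in> tangent_triangle t"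
    using tangent_point_in_tangent_triangle[of "(s + t) / 2" s]
      tangent_point_in_tangent_triangle[of "(s + t) / 2" t] assms by simp_all
  then show ?thesis by blast
qed

text \<open>By convexity only the vertices matter. The form \<open>2 * t * x - y\<close> equals
  \<open>t\<^sup>2\<close> at both ends of the tangent leg and
  \<open>9 * t\<^sup>2 / 10 - 2 * t^4 / 5\<close> at the third vertex; the latter is at least
  \<open>t\<^sup>2 / 2\<close> because \<open>t^4 \<le> t\<^sup>2\<close>.\<close>

lemma tangent_triangle_strip:
  assumes "0 < t" "t \<le> 1" "p \<in> tangent_triangle t"
  shows "t\<^sup>2 / 2 \<le> 2 * t * p$1 - p$2" "2 * t * p$1 - p$2 \<le> t\<^sup>2"
proof -
  have t: "t^4 \<le> t\<^sup>2" "0 \<le> t^4"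
    using assms by (auto intro: power_decreasing)
  define n :: "real^2" where "n = vector [2 * t, -1]"
  have "tangent_triangle t \<subseteq> {p. n \<bullet> p \<le> t\<^sup>2} \<inter> {p. n \<bullet> p \<ge> t\<^sup>2 / 2}"
    unfolding tangent_triangle_def
  proof (rule hull_minimal)
    show "{vector [0, - t\<^sup>2], vector [1, 2 * t - t\<^sup>2], vector [- (t^3 / 5), - t\<^sup>2 + t\<^sup>2 / 10]}
        \<subseteq> {p. n \<bullet> p \<le> t\<^sup>2} \<inter> {p. n \<bullet> p \<ge> t\<^sup>2 / 2}"
      using t by (auto simp: n_def inner_vec_def sum_2 algebra_simps power2_eq_square
          power3_eq_cube power4_eq_xxxx)
  qed (intro convex_Int convex_halfspace_le convex_halfspace_ge)
  then show "t\<^sup>2 / 2 \<le> 2 * t * p$1 - p$2" "2 * t * p$1 - p$2 \<le> t\<^sup>2"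
    using assms(3) by (auto simp: n_def inner_vec_def sum_2)
qed

lemma eventually_not_in_tangent_triangle:
  "\<forall>\<^sub>F t in at_right 0. p \<notin> tangent_triangle t"
proof -
  \<comment> \<open>\<open>c = 1\<close> compares with the upper edge of the strip,
    \<open>c = 1/2\<close> with the lower one.\<close>
  have lim: "((\<lambda>t. 2 * t * p$1 - p$2 - c * t\<^sup>2) \<longlongrightarrow> - p$2) (at_right 0)" for c
    by (auto intro!: tendsto_eq_intros)
  have small: "\<forall>\<^sub>F t in at_right 0. 0 < t \<and> t < \<epsilon>" if "0 < \<epsilon>" for \<epsilon> :: real
    using that by (auto simp: eventually_at_right_field)
  have "\<forall>\<^sub>F t in at_right 0. 2 * t * p$1 - p$2 < t\<^sup>2 / 2 \<or> t\<^sup>2 < 2 * t * p$1 - p$2"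
  proof (cases "p$2" "0::real" rule: linorder_cases)
    case less
    then show ?thesis
      using order_tendstoD(1)[OF lim[of 1], of 0] by (auto elim: eventually_mono)
  next
    case greater
    then show ?thesis
      using order_tendstoD(2)[OF lim[of "1/2"], of 0] by (auto elim: eventually_mono)
  next
    case equal
    show ?thesis
    proof (cases "p$1 > 0")
      \<comment> \<open>On the positive x-axis the upper bound fails once
        \<open>t < 2 * p$1\<close>.\<close>
      case True
      then show ?thesis
        using small[of "2 * p$1"] equal
        by (auto elim!: eventually_mono simp: power2_eq_square)
    next
      \<comment> \<open>Here, the origin included, the lower bound fails for every
        \<open>t > 0\<close>.\<close>
      case False
      have "2 * t * p$1 - p$2 < t\<^sup>2 / 2" if "0 < t" for t
      proof -
        have "2 * t * p$1 \<le> 0"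
          using False that by (simp add: mult_le_0_iff)
        also have "0 < t\<^sup>2 / 2"
          using that by simp
        finally show ?thesis
          using equal by simp
      qed
      then show ?thesis
        using small[of 1] by (auto elim!: eventually_mono)
    qed
  qed
  moreover have "\<forall>\<^sub>F t in at_right 0. 0 < t \<and> t < (1::real)"
    by (rule small) simp
  ultimately show ?thesis
    by eventually_elim (use tangent_triangle_strip in fastforce)
qed

lemma tangent_triangle_subset_cball:
  assumes "0 < t" "t \<le> 1"
  shows "tangent_triangle t \<subseteq> cball 0 4"
  unfolding tangent_triangle_def
proof (rule hull_minimal)
  have t: "t\<^sup>2 \<le> 1" "t^3 \<le> 1" "0 \<le> t^3" "0 \<le> t\<^sup>2"
    using assms by (auto simp: power_le_one)
  \<comment> \<open>A crude bound, giving the vertex with first coordinate 1 an l1 norm of at most 1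
    + 3 = 4, the radius of the ball.\<close>
  then have "\<bar>2 * t - t\<^sup>2\<bar> \<le> 3"
    using assms by linarith
  have "norm (vector [x, y] :: real^2) \<le> \<bar>x\<bar> + \<bar>y\<bar>" for x y
    using norm_le_l1_cart[of "vector [x, y] :: real^2"] by (simp add: sum_2)
  then have norm_le: "norm (vector [x, y] :: real^2) \<le> 4" if "\<bar>x\<bar> + \<bar>y\<bar> \<le> 4" for x y
    using that order_trans by blast
  then show "{vector [0, - t\<^sup>2], vector [1, 2 * t - t\<^sup>2],
      vector [- (t^3 / 5), - t\<^sup>2 + t\<^sup>2 / 10]} \<subseteq> cball (0 :: real^2) 4"
    using t \<open>\<bar>2 * t - t\<^sup>2\<bar> \<le> 3\<close> by (auto intro!: norm_le)
qed simp

theorem theorem18: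
  "\<exists>\<F> :: (real^2) set set.
     infinite \<F> \<and>
     (\<forall>T\<in>\<F>. right_triangle T) \<and>
     (\<forall>S\<in>\<F>. \<forall>T\<in>\<F>. S \<inter> T \<noteq> {}) \<and>
     (\<exists>R>0. \<forall>T\<in>\<F>. diameter T < R) \<and>
     (\<forall>T\<in>\<F>. measure lborel T \<noteq> 0) \<and>
     \<not> (\<exists>P. finite P \<and> (\<forall>T\<in>\<F>. P \<inter> T \<noteq> {}))"
proof (intro exI conjI)
  let ?F = "tangent_triangle ` {0<..1}"
  show inter: "\<forall>S\<in>?F. \<forall>T\<in>?F. S \<inter> T \<noteq> {}"
    using tangent_triangles_intersect by auto
  show no_piercing: "\<not> (\<exists>P. finite P \<and> (\<forall>T\<in>?F. P \<inter> T \<noteq> {}))"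
  proof
    assume "\<exists>P. finite P \<and> (\<forall>T\<in>?F. P \<inter> T \<noteq> {})"
    then obtain P where P: "finite P" "\<And>t. 0 < t \<Longrightarrow> t \<le> 1 \<Longrightarrow> P \<inter> tangent_triangle t \<noteq> {}"
      by auto
    have "\<forall>\<^sub>F t in at_right 0. \<forall>p\<in>P. p \<notin> tangent_triangle t"
      by (intro eventually_ball_finite P(1) ballI eventually_not_in_tangent_triangle)
    moreover have "\<forall>\<^sub>F t in at_right 0. 0 < t \<and> t < (1::real)"
      by (auto simp: eventually_at_right_field intro: exI[of _ 1])
    ultimately have "\<forall>\<^sub>F t in at_right (0::real). False"
      by eventually_elim (use P(2) in fastforce)
    then show False by simp
  qed
  \<comment> \<open>Choosing one point from each member of a finite family of nonempty sets would
    give a finite piercing set.\<close>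
  show "infinite ?F"
  proof
    assume "finite ?F"
    then have "finite ((\<lambda>T. SOME p. p \<in> T) ` ?F)" by (rule finite_imageI)
    moreover have "(SOME p. p \<in> T) \<in> T" if "T \<in> ?F" for T
      using inter that by (metis Int_absorb some_in_eq)
    ultimately show False using no_piercing by blast
  qed
  show "\<forall>T\<in>?F. right_triangle T"
    using right_triangle_tangent_triangle by auto
  show "\<forall>T\<in>?F. measure lborel T \<noteq> 0"
    using measure_tangent_triangle by force
  show "\<forall>T\<in>?F. diameter T < 9"
  proof
    fix T assume "T \<in> ?F"
    then have "T \<subseteq> cball 0 4"
      using tangent_triangle_subset_cball by (metis greaterThanAtMost_iff imageE)
    then have "diameter T \<le> diameter (cball (0 :: real^2) 4)" by (intro diameter_subset) auto
    then show "diameter T < 9" by simp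
  qed
qed simp

end
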